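(* Fix a real number $\gamma(0)>0$. For $b\in[0,2]$ let $\gamma_b:\mathbb{Z}\to\mathbb{R}$ be the (unique) function with $\gamma_b(0)=\gamma(0)$ that is symmetric, i.e. $\gamma_b(-m)=\gamma_b(m)$ for all $m\in\mathbb{Z}$, and satisfies $$\gamma_b(m+1)=b\,\gamma_b(m)-\gamma_b(m-1)\qquad\text{for all } m\in\mathbb{Z}.$$ Then the following hold. (1) If $b=2\sin\left(\frac{k}{l}\frac{\pi}{2}\right)$, where $k$ and $l$ are strictly positive integers such that $\frac{k}{l}\in(0,1)$, then $\gamma_b$ is periodic, i.e. there is an integer $N\geq 1$ with $\gamma_b(m+N)=\gamma_b(m)$ for all $m\in\mathbb{Z}$. (2) If $b=2\sin\left(r\frac{\pi}{2}\right)$, where $r\in(0,1)\setminus\mathbb{Q}$, then for every integer $M\geq 0$ the set $\{\gamma_b(M+m): m\in\mathbb{Z},\ m\geq 0\}$ is dense in $[-\gamma(0),\gamma(0)]$. (3) For every $b\in[0,2]$, $\gamma_b$ is a covariance function.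
   Context: A function $\gamma:\mathbb{Z}\to\mathbb{R}$ is called a covariance function if it is the autocovariance function of some square integrable real-valued stationary process $(X_t)_{t\in\mathbb{Z}}$, i.e. $\gamma(m)=\mathrm{Cov}(X_{t+m},X_t)$ for all $t,m\in\mathbb{Z}$. Equivalently, $\gamma$ is symmetric and positive semidefinite: for all $n\in\mathbb{N}$, $t_1,\dots,t_n\in\mathbb{Z}$ and $a_1,\dots,a_n\in\mathbb{R}$ one has $\sum_{i,j=1}^n a_i\gamma(t_i-t_j)a_j\geq 0$. Note that symmetry together with the recursion at $m=0$ forces $\gamma_b(1)=\frac{b}{2}\gamma_b(0)$. *)

theory Defs
  imports "HOL-Probability.Probability"
begin

definition square_integrable_process :: "'a measure \<Rightarrow> (int \<Rightarrow> 'a \<Rightarrow> real) \<Rightarrow> bool" where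
  "square_integrable_process M X \<longleftrightarrow>
     (\<forall>t. X t \<in> borel_measurable M \<and> integrable M (\<lambda>\<omega>. (X t \<omega>)\<^sup>2))"

text \<open>Strict stationarity: the finite-dimensional distributions are invariant under time
  shifts.  For square integrable processes this implies weak stationarity (constant mean,
  autocovariances that depend on the lag only).\<close>

definition stationary_process :: "'a measure \<Rightarrow> (int \<Rightarrow> 'a \<Rightarrow> real) \<Rightarrow> bool" where
  "stationary_process M X \<longleftrightarrow>
     (\<forall>h. \<forall>J. finite J \<longrightarrow>
        distr M (\<Pi>\<^sub>M t\<in>J. borel) (\<lambda>\<omega>. \<lambda>t\<in>J. X (t + h) \<omega>) =
        distr M (\<Pi>\<^sub>M t\<in>J. borel) (\<lambda>\<omega>. \<lambda>t\<in>J. X t \<omega>))"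

definition covariance :: "'a measure \<Rightarrow> ('a \<Rightarrow> real) \<Rightarrow> ('a \<Rightarrow> real) \<Rightarrow> real" where
  "covariance M Y Z =
     integral\<^sup>L M (\<lambda>\<omega>. (Y \<omega> - integral\<^sup>L M Y) * (Z \<omega> - integral\<^sup>L M Z))"

text \<open>HOL cannot quantify existentially over the type of the sample space, so it is fixed to
  the path space \<open>int \<Rightarrow> real\<close>, with an arbitrary \<open>\<sigma>\<close>-algebra and probability measure.
  This loses no generality: a process on any probability space can be replaced by the
  coordinate process under its law on path space, which has the same finite-dimensional
  distributions.\<close>

definition covariance_function :: "(int \<Rightarrow> real) \<Rightarrow> bool" where
  "covariance_function \<gamma> \<longleftrightarrow>
     (\<exists>(M :: (int \<Rightarrow> real) measure) X.
        prob_space M \<and> square_integrable_process M X \<and> stationary_process M X \<and>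
        (\<forall>t m. \<gamma> m = covariance M (X (t + m)) (X t)))"

definition symmetric_solution :: "real \<Rightarrow> real \<Rightarrow> (int \<Rightarrow> real) \<Rightarrow> bool" where
  "symmetric_solution \<gamma>0 b g \<longleftrightarrow>
     g 0 = \<gamma>0 \<and> (\<forall>m. g (- m) = g m) \<and> (\<forall>m. g (m + 1) = b * g m - g (m - 1))"

end

theory Submission
  imports Defs
begin

text \<open>Writing \<open>b = 2 cos \<theta>\<close>, the recursion is the addition theorem, so
  \<open>\<gamma>\<^sub>b m = \<gamma>(0) cos (\<theta> m)\<close>; for \<open>b = 2 sin (r \<pi>/2)\<close> the frequency is
  \<open>\<theta> = 2\<pi> (1 - r)/4\<close>. Rational \<open>r\<close> gives a period, irrational \<open>r\<close> gives density by
  Kronecker's approximation theorem. The covariance is that of the random-phase oscillation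
  \<open>X\<^sub>t = sqrt (2 \<gamma>(0)) cos (\<theta> t + U)\<close> with \<open>U\<close> uniform on the circle; both its
  stationarity and its moments follow from the rotation invariance of \<open>U\<close>.\<close>

section \<open>Cosine solutions of the recursion\<close>

lemma symmetric_solution_cos:
  "symmetric_solution a (2 * cos \<theta>) (\<lambda>m. a * cos (\<theta> * of_int m))"
proof -
  have "cos (\<theta> * of_int (m + 1)) = 2 * cos \<theta> * cos (\<theta> * of_int m) - cos (\<theta> * of_int (m - 1))" for m
    by (simp add: ring_distribs cos_add cos_diff)
  then show ?thesis
    unfolding symmetric_solution_def by (simp add: ring_distribs)
qed

text \<open>Symmetry supplies the missing second initial value: at \<open>m = 0\<close> the
  recursion becomes \<open>2 * h 1 = b * a\<close>. Two-step induction then settles the nonnegative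
  integers, and symmetry the negative ones.\<close>

lemma symmetric_solution_unique:
  assumes f: "symmetric_solution a b f" and g: "symmetric_solution a b g"
  shows "f = g"
proof
  have one: "h 1 = b * a / 2" if "symmetric_solution a b h" for h
  proof -
    have "h (0 + 1) = b * h 0 - h (0 - 1)" "h (- 1) = h 1" "h 0 = a"
      using that unfolding symmetric_solution_def by blast+
    then show ?thesis by simp
  qed
  have nat: "f (int n) = g (int n)" for n
  proof (induction n rule: induct_nat_012)
    case 0
    then show ?case using f g by (simp add: symmetric_solution_def)
  next
    case 1
    then show ?case using one[OF f] one[OF g] by simp
  next
    case (ge2 n)
    have "h (int (Suc (Suc n))) = b * h (int (Suc n)) - h (int n)"
      if "symmetric_solution a b h" for h
    proof -
      have "h (int (Suc n) + 1) = b * h (int (Suc n)) - h (int (Suc n) - 1)"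
        using that unfolding symmetric_solution_def by blast
      then show ?thesis by (simp add: add.commute)
    qed
    from this[OF f] this[OF g] ge2 show ?case by simp
  qed
  fix m :: int
  have "h m = h (int (nat \<bar>m\<bar>))" if "symmetric_solution a b h" for h
    using that by (simp add: symmetric_solution_def abs_if)
  from this[OF f] this[OF g] nat show "f m = g m" by metis
qed

lemma symmetric_solution_eq_cos:
  assumes "symmetric_solution a (2 * cos \<theta>) g"
  shows "g = (\<lambda>m. a * cos (\<theta> * of_int m))"
  using symmetric_solution_unique[OF assms symmetric_solution_cos] .

section \<open>Density along an irrational rotation\<close>

text \<open>By Kronecker's theorem the multiples of an irrational \<alpha> are dense modulo 1, so
  the angles come arbitrarily close to \<open>arccos y\<close> modulo full turns; continuity of the
  cosine does the rest.\<close>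

lemma cos_multiples_dense:
  fixes \<alpha> y :: real and M :: int
  assumes \<alpha>: "\<alpha> \<notin> \<rat>" and y: "\<bar>y\<bar> \<le> 1" and "0 < e"
  obtains k :: int where "0 < k" "\<bar>cos (2 * pi * \<alpha> * of_int (M + k)) - y\<bar> < e"
proof -
  define \<phi> where "\<phi> = arccos y"
  have \<phi>: "cos \<phi> = y"
    using y unfolding \<phi>_def by (intro cos_arccos) auto
  obtain d where "0 < d" and d: "\<And>x. \<bar>x - \<phi>\<bar> < d \<Longrightarrow> \<bar>cos x - cos \<phi>\<bar> < e"
    using isCont_cos[of \<phi>] \<open>0 < e\<close> unfolding continuous_at_eps_delta dist_real_def by blast
  have "0 < d / (2 * pi)" using \<open>0 < d\<close> by simp
  \<comment> \<open>The target is the angle \<phi> measured in full turns, with the fixed offset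
    from \<open>M\<close> moved to the right-hand side.\<close>
  then obtain h k :: int where "0 < k"
    and *: "\<bar>of_int k * \<alpha> - of_int h - (\<phi> / (2 * pi) - \<alpha> * of_int M)\<bar> < d / (2 * pi)"
    by (rule sequence_of_fractional_parts_is_dense[OF \<alpha>])
  \<comment> \<open>Removing \<open>h\<close> full turns brings the angle itself near \<phi> without
    changing its cosine.\<close>
  define x where "x = 2 * pi * \<alpha> * of_int (M + k) - of_int h * (2 * pi)"
  have "x - \<phi> = (2 * pi) * (of_int k * \<alpha> - of_int h - (\<phi> / (2 * pi) - \<alpha> * of_int M))"
    by (simp add: x_def field_simps)
  then have "\<bar>x - \<phi>\<bar>
      = (2 * pi) * \<bar>of_int k * \<alpha> - of_int h - (\<phi> / (2 * pi) - \<alpha> * of_int M)\<bar>"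
    by (simp add: abs_mult)
  also have "\<dots> < (2 * pi) * (d / (2 * pi))"
    using * by (rule mult_strict_left_mono) simp
  finally have "\<bar>x - \<phi>\<bar> < d" by simp
  moreover have "cos x = cos (2 * pi * \<alpha> * of_int (M + k))"
    unfolding x_def cos_diff using cos_int_2pin[of h] sin_int_2pin[of h] by (simp add: mult_ac)
  ultimately show ?thesis
    using that[OF \<open>0 < k\<close>] d[of x] \<phi> by simp
qed

section \<open>Rotation invariance of the uniform phase\<close>

lemma emeasure_lborel_vimage_plus:
  fixes A :: "real set"
  assumes "A \<in> sets borel"
  shows "emeasure lborel {x. x + c \<in> A} = emeasure lborel A"
proof -
  have "emeasure lborel A = emeasure (distr lborel borel ((+) c)) A"
    by (simp add: lborel_distr_plus)
  also have "\<dots> = emeasure lborel {x. x + c \<in> A}"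
    using assms by (subst emeasure_distr) (auto simp: vimage_def add.commute)
  finally show ?thesis by simp
qed

text \<open>Reduce \<open>c\<close> modulo \<open>p\<close> to \<open>d\<close>. The window from
  \<open>d\<close> to \<open>d + p\<close> is cut at \<open>p\<close>; its overhang, moved back by
  one period, fills the gap from \<open>0\<close> to \<open>d\<close>.\<close>

lemma emeasure_lborel_periodic:
  fixes B :: "real set"
  assumes [measurable]: "B \<in> sets borel" and "0 < p"
    and per: "\<And>x. x + p \<in> B \<longleftrightarrow> x \<in> B"
  shows "emeasure lborel (B \<inter> {c..<c + p}) = emeasure lborel (B \<inter> {0..<p})"
proof -
  have per_int: "x + of_int n * p \<in> B \<longleftrightarrow> x \<in> B" for x and n :: int
  proof (induction n rule: int_induct[where k = 0])
    case (step1 i)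
    then show ?case using per[of "x + of_int i * p"] by (simp add: algebra_simps)
  next
    case (step2 i)
    then show ?case using per[of "x + of_int (i - 1) * p"] by (simp add: algebra_simps)
  qed simp
  define n where "n = \<lfloor>c / p\<rfloor>"
  define d where "d = c - of_int n * p"
  have "of_int n \<le> c / p" "c / p < of_int n + 1"
    unfolding n_def by linarith+
  then have d: "0 \<le> d" "d < p"
    using \<open>0 < p\<close> by (auto simp: d_def field_simps)
  have "{x. x + of_int n * p \<in> B \<inter> {c..<c + p}} = B \<inter> {d..<d + p}"
    using per_int by (auto simp: d_def)
  then have "emeasure lborel (B \<inter> {c..<c + p}) = emeasure lborel (B \<inter> {d..<d + p})"
    using emeasure_lborel_vimage_plus[of "B \<inter> {c..<c + p}" "of_int n * p"] by simp
  also have "\<dots> = emeasure lborel (B \<inter> {d..<p}) + emeasure lborel (B \<inter> {p..<d + p})"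
    using d by (subst plus_emeasure) (auto intro!: arg_cong[where f = "emeasure lborel"])
  also have "{x. x + p \<in> B \<inter> {p..<d + p}} = B \<inter> {0..<d}"
    using per by auto
  then have "emeasure lborel (B \<inter> {p..<d + p}) = emeasure lborel (B \<inter> {0..<d})"
    using emeasure_lborel_vimage_plus[of "B \<inter> {p..<d + p}" p] by simp
  also have "emeasure lborel (B \<inter> {d..<p}) + emeasure lborel (B \<inter> {0..<d})
      = emeasure lborel (B \<inter> {0..<p})"
    using d by (subst plus_emeasure) (auto intro!: arg_cong[where f = "emeasure lborel"])
  finally show ?thesis .
qed

definition uniform_phase :: "real measure" where
  "uniform_phase = uniform_measure lborel {0..<2 * pi}"

lemma sets_uniform_phase [simp, measurable_cong]: "sets uniform_phase = sets borel"
  by (simp add: uniform_phase_def)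

lemma space_uniform_phase [simp]: "space uniform_phase = UNIV"
  by (simp add: uniform_phase_def)

lemma prob_space_uniform_phase: "prob_space uniform_phase"
  unfolding uniform_phase_def by (rule prob_space_uniform_measure) simp_all

text \<open>Shifting the phase replaces the window starting at \<open>0\<close> by the one starting
  at \<open>c\<close>, and a periodic preimage has equal mass in both. The target \<open>N\<close>
  is kept general so that \<open>F\<close> may be real-valued or a whole finite family of process
  values.\<close>

lemma distr_uniform_phase_shift:
  assumes [measurable]: "F \<in> borel \<rightarrow>\<^sub>M N" and per: "\<And>u. F (u + 2 * pi) = F u"
  shows "distr uniform_phase N (\<lambda>u. F (u + c)) = distr uniform_phase N F"
proof (rule measure_eqI)
  fix A assume "A \<in> sets (distr uniform_phase N (\<lambda>u. F (u + c)))"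
  then have A [measurable]: "A \<in> sets N" by simp
  define B where "B = F -` A"
  have B [measurable]: "B \<in> sets borel"
    using measurable_sets[OF assms(1) A] by (simp add: B_def)
  have [measurable]: "{u. u + c \<in> B} \<in> sets borel"
    using measurable_sets[of "\<lambda>u. u + c" borel borel B] by (simp add: vimage_def)
  have "emeasure lborel ({0..<2 * pi} \<inter> {u. u + c \<in> B})
      = emeasure lborel {u. u + c \<in> B \<inter> {c..<c + 2 * pi}}"
    by (intro arg_cong[where f = "emeasure lborel"]) auto
  also have "\<dots> = emeasure lborel ({0..<2 * pi} \<inter> B)"
    using emeasure_lborel_periodic[OF B, of "2 * pi" c] per
    by (subst emeasure_lborel_vimage_plus) (auto simp: B_def Int_commute)
  finally have "emeasure uniform_phase {u. u + c \<in> B} = emeasure uniform_phase B"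
    by (simp add: uniform_phase_def)
  then show "emeasure (distr uniform_phase N (\<lambda>u. F (u + c))) A
      = emeasure (distr uniform_phase N F) A"
    by (simp add: emeasure_distr B_def vimage_def)
qed simp

section \<open>Moments of the uniform phase\<close>

lemma integral_uniform_phase_shift:
  fixes f :: "real \<Rightarrow> real"
  assumes [measurable]: "f \<in> borel_measurable borel" and per: "\<And>u. f (u + 2 * pi) = f u"
  shows "(LINT u|uniform_phase. f (u + c)) = (LINT u|uniform_phase. f u)"
proof -
  have "(LINT u|uniform_phase. f (u + c)) = (LINT x|distr uniform_phase borel (\<lambda>u. f (u + c)). x)"
    by (subst integral_distr) auto
  also have "\<dots> = (LINT x|distr uniform_phase borel f. x)"
    using distr_uniform_phase_shift[OF assms] by simp
  also have "\<dots> = (LINT u|uniform_phase. f u)"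
    by (subst integral_distr) auto
  finally show ?thesis .
qed

text \<open>Shift invariance makes the integral equal to its own negative, which spares computing
  antiderivatives.\<close>

lemma integral_uniform_phase_antiperiodic:
  fixes f :: "real \<Rightarrow> real"
  assumes "f \<in> borel_measurable borel" and "\<And>u. f (u + 2 * pi) = f u"
    and "\<And>u. f (u + c) = - f u"
  shows "(LINT u|uniform_phase. f u) = 0"
  using integral_uniform_phase_shift[OF assms(1,2), of c] assms(3) by simp

lemma integral_uniform_phase_cos: "(LINT u|uniform_phase. cos (a + u)) = 0"
  by (rule integral_uniform_phase_antiperiodic[where c = pi])
    (simp_all add: add.assoc[symmetric] cos_add)

text \<open>The product-to-sum formula leaves a constant and an oscillation in \<open>2 * u\<close>;
  the latter averages to zero, since advancing \<open>u\<close> by a quarter turn flips its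
  sign.\<close>

lemma integral_uniform_phase_cos_mult:
  "(LINT u|uniform_phase. cos (a + u) * cos (b + u)) = cos (a - b) / 2"
proof -
  interpret prob_space uniform_phase by (rule prob_space_uniform_phase)
  have int: "integrable uniform_phase (\<lambda>u. cos (a + b + 2 * u))"
    by (rule integrable_const_bound[where B = 1]) auto
  have zero: "(LINT u|uniform_phase. cos (a + b + 2 * u)) = 0"
    by (rule integral_uniform_phase_antiperiodic[where c = "pi / 2"])
      (simp_all add: ring_distribs add.assoc[symmetric] cos_add)
  have "cos (a + u) * cos (b + u) = (cos (a - b) + cos (a + b + 2 * u)) / 2" for u
    by (simp add: cos_times_cos algebra_simps)
  then have "(LINT u|uniform_phase. cos (a + u) * cos (b + u))
      = (LINT u|uniform_phase. (cos (a - b) + cos (a + b + 2 * u)) / 2)"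
    by (simp only:)
  also have "\<dots> = cos (a - b) / 2"
    using int zero prob_space by simp
  finally show ?thesis .
qed

section \<open>The random-phase process\<close>

lemma covariance_function_cos:
  assumes "0 \<le> a"
  shows "covariance_function (\<lambda>m. a * cos (\<theta> * of_int m))"
proof -
  define S where "S = (\<Pi>\<^sub>M t\<in>(UNIV :: int set). (borel :: real measure))"
  \<comment> \<open>The sample space is forced to be path space; the phase is carried by constant paths.\<close>
  define M where "M = distr uniform_phase S (\<lambda>u _. u)"
  \<comment> \<open>The factor 2 compensates the factor 1/2 in the mean product of two
    cosines.\<close>
  define s where "s = sqrt (2 * a)"
  define X where "X = (\<lambda>t (\<omega> :: int \<Rightarrow> real). s * cos (\<theta> * of_int t + \<omega> 0))"
  interpret U: prob_space uniform_phase by (rule prob_space_uniform_phase)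
  have const: "(\<lambda>u _. u) \<in> uniform_phase \<rightarrow>\<^sub>M S"
    unfolding S_def by (rule measurable_PiM_single') (auto simp: PiE_def)
  have coord [measurable]: "(\<lambda>\<omega>. \<omega> 0) \<in> borel_measurable S"
    unfolding S_def by (rule measurable_component_singleton) simp
  have X_S [measurable]: "X t \<in> borel_measurable S" for t
    unfolding X_def by measurable
  have setsM [simp, measurable_cong]: "sets M = sets S"
    by (simp add: M_def)
  have M: "prob_space M"
    unfolding M_def by (rule U.prob_space_distr[OF const])
  then interpret prob_space M .
  have integral_M: "(LINT \<omega>|M. f (\<omega> 0)) = (LINT u|uniform_phase. f u)"
    if "f \<in> borel_measurable borel" for f :: "real \<Rightarrow> real"
  proof -
    have "(\<lambda>\<omega>. f (\<omega> 0)) \<in> borel_measurable S"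
      by (rule measurable_compose[OF coord that])
    from integral_distr[OF const this] show ?thesis unfolding M_def .
  qed
  have square: "square_integrable_process M X"
    unfolding square_integrable_process_def
  proof (intro allI conjI)
    fix t
    show "X t \<in> borel_measurable M" by measurable
    have "(X t \<omega>)\<^sup>2 \<le> s\<^sup>2" for \<omega>
      unfolding X_def power_mult_distrib
      by (rule mult_left_le) (simp_all add: abs_square_le_1)
    then show "integrable M (\<lambda>\<omega>. (X t \<omega>)\<^sup>2)"
      by (intro integrable_const_bound[where B = "s\<^sup>2"]) auto
  qed
  have stationary: "stationary_process M X"
    unfolding stationary_process_def
  proof (intro allI impI)
    fix h :: int and J :: "int set"
    let ?N = "\<Pi>\<^sub>M t\<in>J. (borel :: real measure)"
    \<comment> \<open>As a function of the phase, the family over \<open>J\<close> turns a time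
      shift by \<open>h\<close> into a phase shift by \<open>\<theta> * of_int h\<close>.\<close>
    define F where "F = (\<lambda>u. \<lambda>t\<in>J. s * cos (\<theta> * of_int t + u))"
    have F: "F \<in> borel \<rightarrow>\<^sub>M ?N"
      unfolding F_def by measurable
    have per: "F (u + 2 * pi) = F u" for u
      unfolding F_def by (simp add: add.assoc[symmetric])
    have path: "(\<lambda>\<omega>. \<lambda>t\<in>J. X (t + i) \<omega>) \<in> S \<rightarrow>\<^sub>M ?N" for i
      by (rule measurable_restrict) (rule X_S)
    have "distr M ?N (\<lambda>\<omega>. \<lambda>t\<in>J. X (t + h) \<omega>)
        = distr uniform_phase ?N (\<lambda>u. F (u + \<theta> * of_int h))"
      unfolding M_def distr_distr[OF path const]
      by (simp add: F_def X_def comp_def algebra_simps)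
    also have "\<dots> = distr uniform_phase ?N F"
      by (rule distr_uniform_phase_shift[OF F per])
    also have "\<dots> = distr M ?N (\<lambda>\<omega>. \<lambda>t\<in>J. X t \<omega>)"
      unfolding M_def using distr_distr[OF path[of 0] const]
      by (simp add: F_def X_def comp_def)
    finally show "distr M ?N (\<lambda>\<omega>. \<lambda>t\<in>J. X (t + h) \<omega>) = distr M ?N (\<lambda>\<omega>. \<lambda>t\<in>J. X t \<omega>)" .
  qed
  have mean: "(LINT \<omega>|M. X t \<omega>) = 0" for t
    using integral_M[of "\<lambda>u. s * cos (\<theta> * of_int t + u)"]
    by (simp add: X_def integral_uniform_phase_cos)
  have "covariance M (X (t + m)) (X t) = a * cos (\<theta> * of_int m)" for t m
  proof -
    have "covariance M (X (t + m)) (X t)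
        = (LINT u|uniform_phase.
             s\<^sup>2 * (cos (\<theta> * of_int (t + m) + u) * cos (\<theta> * of_int t + u)))"
      unfolding covariance_def mean
      using integral_M[of "\<lambda>u. s\<^sup>2 * (cos (\<theta> * of_int (t + m) + u) * cos (\<theta> * of_int t + u))"]
      by (simp add: X_def power2_eq_square mult_ac)
    also have "\<dots> = s\<^sup>2 * (cos (\<theta> * of_int m) / 2)"
      using integral_uniform_phase_cos_mult[of "\<theta> * of_int (t + m)" "\<theta> * of_int t"]
      by (simp add: ring_distribs)
    finally show ?thesis using assms by (simp add: s_def)
  qed
  then show ?thesis
    unfolding covariance_function_def using M square stationary by metis
qed

section \<open>Periodicity, density and covariance of the solutions\<close>

theorem theorem2p1:
  fixes \<gamma>0 :: real and \<gamma> :: "real \<Rightarrow> int \<Rightarrow> real"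
  assumes "\<gamma>0 > 0"
    and "\<And>b. b \<in> {0..2} \<Longrightarrow> symmetric_solution \<gamma>0 b (\<gamma> b)"
  shows "(\<forall>b\<in>{0..2}. \<exists>!g. symmetric_solution \<gamma>0 b g) \<and>
    (\<forall>b\<in>{0..2}. \<forall>k l :: nat.
        0 < k \<and> 0 < l \<and> real k / real l \<in> {0<..<1} \<and> b = 2 * sin (real k / real l * (pi / 2)) \<longrightarrow>
        (\<exists>N::int. N \<ge> 1 \<and> (\<forall>m. \<gamma> b (m + N) = \<gamma> b m))) \<and>
    (\<forall>b\<in>{0..2}. \<forall>r::real.
        r \<in> {0<..<1} - \<rat> \<and> b = 2 * sin (r * (pi / 2)) \<longrightarrow>
        (\<forall>M::int. M \<ge> 0 \<longrightarrow>
           {\<gamma> b (M + m) | m. m \<ge> 0} \<subseteq> {-\<gamma>0..\<gamma>0} \<and>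
           {-\<gamma>0..\<gamma>0} \<subseteq> closure {\<gamma> b (M + m) | m. m \<ge> 0})) \<and>
    (\<forall>b\<in>{0..2}. covariance_function (\<gamma> b))"
proof (intro conjI ballI allI impI)
  note sol = assms(2)
  have cos_form: "\<gamma> b = (\<lambda>m. \<gamma>0 * cos (\<theta> * of_int m))" if "b \<in> {0..2}" "b = 2 * cos \<theta>" for b \<theta>
    using sol[OF that(1)] symmetric_solution_eq_cos[of \<gamma>0 \<theta>] that(2) by simp
  \<comment> \<open>The complementary angle turns sine into cosine; counted in full turns it is
    \<open>(1 - r) / 4\<close>, whose rationality decides between periodicity and density.\<close>
  have sin_form: "\<gamma> b = (\<lambda>m. \<gamma>0 * cos (2 * pi * ((1 - r) / 4) * of_int m))"
    if "b \<in> {0..2}" "b = 2 * sin (r * (pi / 2))" for b r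
  proof (rule cos_form[OF that(1)])
    have "2 * pi * ((1 - r) / 4) = pi / 2 - r * (pi / 2)"
      by (simp add: field_simps)
    then show "b = 2 * cos (2 * pi * ((1 - r) / 4))"
      using that(2) by (simp only: cos_diff) simp
  qed
  {
    fix b :: real assume b: "b \<in> {0..2}"
    show "\<exists>!g. symmetric_solution \<gamma>0 b g"
      using sol[OF b] symmetric_solution_unique by blast
    have "b = 2 * cos (arccos (b / 2))"
      using b by (subst cos_arccos) auto
    then have "\<gamma> b = (\<lambda>m. \<gamma>0 * cos (arccos (b / 2) * of_int m))"
      by (rule cos_form[OF b])
    then show "covariance_function (\<gamma> b)"
      using covariance_function_cos[of \<gamma>0] assms(1) by simp
  }
  {
    fix b :: real and k l :: nat
    assume b: "b \<in> {0..2}"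
      and kl: "0 < k \<and> 0 < l \<and> real k / real l \<in> {0<..<1} \<and> b = 2 * sin (real k / real l * (pi / 2))"
    \<comment> \<open>Over \<open>4 * l\<close> steps the phase advances by
      \<open>(1 - k / l) * l = l - k\<close> full turns, an integer.\<close>
    have "\<gamma> b (m + 4 * int l) = \<gamma> b m" for m
    proof -
      define j where "j = int l - int k"
      have "2 * pi * ((1 - real k / real l) / 4) * of_int (m + 4 * int l)
          = 2 * pi * ((1 - real k / real l) / 4) * of_int m + 2 * pi * of_int j"
      proof -
        have "of_int j = (1 - real k / real l) * real l"
          using kl by (simp add: j_def left_diff_distrib)
        then show ?thesis by (simp add: ring_distribs)
      qed
      then show ?thesis
        using sin_form[OF b, of "real k / real l"] kl cos_int_2pin[of j] sin_int_2pin[of j]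
        by (simp only: cos_add) simp
    qed
    then show "\<exists>N::int. N \<ge> 1 \<and> (\<forall>m. \<gamma> b (m + N) = \<gamma> b m)"
      using kl by (intro exI[of _ "4 * int l"]) auto
  }
  {
    fix b r :: real and M :: int
    assume b: "b \<in> {0..2}" and r: "r \<in> {0<..<1} - \<rat> \<and> b = 2 * sin (r * (pi / 2))"
    define \<alpha> where "\<alpha> = (1 - r) / 4"
    have form: "\<gamma> b = (\<lambda>m. \<gamma>0 * cos (2 * pi * \<alpha> * of_int m))"
      using sin_form[OF b] r by (simp add: \<alpha>_def)
    have "r = 1 - 4 * \<alpha>" by (simp add: \<alpha>_def field_simps)
    then have \<alpha>: "\<alpha> \<notin> \<rat>" using r by auto
    show "{\<gamma> b (M + m) | m. m \<ge> 0} \<subseteq> {-\<gamma>0..\<gamma>0}"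
    proof clarify
      fix m
      have "\<bar>\<gamma> b (M + m)\<bar> \<le> \<gamma>0"
        using assms(1) unfolding form by (simp add: abs_mult mult_left_le)
      then show "\<gamma> b (M + m) \<in> {-\<gamma>0..\<gamma>0}" by auto
    qed
    show "{-\<gamma>0..\<gamma>0} \<subseteq> closure {\<gamma> b (M + m) | m. m \<ge> 0}"
    proof
      fix y assume y: "y \<in> {-\<gamma>0..\<gamma>0}"
      show "y \<in> closure {\<gamma> b (M + m) | m. m \<ge> 0}"
        unfolding closure_approachable
      proof (intro allI impI)
        fix e :: real assume "0 < e"
        \<comment> \<open>Target and tolerance are divided by the amplitude to reach the
          unit-amplitude density lemma.\<close>
        then have "0 < e / \<gamma>0" using assms(1) by simp
        moreover have "\<bar>y / \<gamma>0\<bar> \<le> 1" using y assms(1) by (auto simp: abs_le_iff field_simps)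
        ultimately obtain k where "0 < k"
          and k: "\<bar>cos (2 * pi * \<alpha> * of_int (M + k)) - y / \<gamma>0\<bar> < e / \<gamma>0"
          using cos_multiples_dense[OF \<alpha>] by metis
        have "\<gamma> b (M + k) - y = \<gamma>0 * (cos (2 * pi * \<alpha> * of_int (M + k)) - y / \<gamma>0)"
          using assms(1) by (simp add: form right_diff_distrib)
        then have "dist (\<gamma> b (M + k)) y < e"
          using k assms(1) by (simp add: dist_real_def abs_mult pos_less_divide_eq mult.commute)
        then show "\<exists>z\<in>{\<gamma> b (M + m) | m. m \<ge> 0}. dist z y < e"
          using less_imp_le[OF \<open>0 < k\<close>] by blast
      qed
    qed
  }
qed

end
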